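(* Let $k,N_J,N_K\le n$ be natural numbers and $\rho_J,\rho_K>0$. Given the pre-change estimate $\hat f_-$ (i.e. its two coefficients) as input, the FLOC detector can be run sequentially on the stream $X_1,X_2,\dots,X_n$ (deciding at each time $m>k$, upon arrival of $X_m$, whether $|J_m|\ge\rho_J$ or $|K_m|\ge\rho_K$) such that: (i) the computational cost is $\mathcal O(1)$ per incoming observation; (ii) the storage cost is $\mathcal O(1)$. Here the $\mathcal O(1)$ bounds are absolute constants, in particular independent of $n$, of the number of observations seen so far, and of the bin sizes $N_J,N_K$.
   Context: Costs are counted in a unit-cost model: arithmetic operations, comparisons and remainders on real numbers/indices each cost one unit of time, and each stored number costs one unit of memory. Pre-change estimate: $\hat f_-(i/n)=\hat\alpha+\hat\beta\, i/n$, where $(\hat\alpha,\hat\beta)=\arg\min_{(\alpha,\beta)\in\mathbb R^2}\sum_{i=1}^k(\alpha+\beta i/n-X_i)^2$. Test statistics, for $k<m\le n$: with $M_J=2N_J+(m\bmod N_J)$, $$J_m=\frac1{M_J}\sum_{i=1}^{M_J}\Bigl(X_{m-M_J+i}-\hat f_-\bigl(\tfrac{m-M_J+i}{n}\bigr)\Bigr),$$ and with $M_K=2N_K+(m\bmod N_K)$, $$K_m=\frac{6}{M_K(M_K+1)(2M_K+1)}\sum_{i=1}^{M_K}i\Bigl(X_{m-M_K+i}-\hat f_-\bigl(\tfrac{m-M_K+i}{n}\bigr)\Bigr)$$ (all window indices being assumed to be at least $1$). Detectors: $\hat\tau_{J,n}=\min\{m:|J_m|\ge\rho_J,\ k<m\le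 n\}/n$ if this set is nonempty, and $1$ otherwise; $\hat\tau_{K,n}=\min\{m:|K_m|\ge\rho_K,\ k<m\le n\}/n$ if this set is nonempty, and $1$ otherwise. The FLOC detector is $\hat\tau_n=\min(\hat\tau_{J,n},\hat\tau_{K,n})$. *)

theory Defs
  imports Complex_Main "HOL-Library.Monad_Syntax"
begin

section \<open>The FLOC detector\<close>

definition pre_fit :: "real \<times> real \<Rightarrow> real \<Rightarrow> real" where
  "pre_fit ab x = fst ab + snd ab * x"

text \<open>A minimiser of the least-squares objective; it is unique for \<open>k \<ge> 2\<close>. For \<open>k = 1\<close> every
  minimiser is admitted.\<close>

definition is_pre_change_estimate :: "nat \<Rightarrow> nat \<Rightarrow> (nat \<Rightarrow> real) \<Rightarrow> real \<times> real \<Rightarrow> bool" where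
  "is_pre_change_estimate n k X ab \<longleftrightarrow>
     is_arg_min (\<lambda>(a, b). \<Sum>i = 1..k. (a + b * (real i / real n) - X i)\<^sup>2) (\<lambda>_. True) ab"

definition window :: "nat \<Rightarrow> nat \<Rightarrow> nat" where
  "window N m = 2 * N + m mod N"

definition J_stat :: "nat \<Rightarrow> nat \<Rightarrow> real \<times> real \<Rightarrow> (nat \<Rightarrow> real) \<Rightarrow> nat \<Rightarrow> real" where
  "J_stat n N ab X m =
     (let M = window N m in
      1 / real M * (\<Sum>i = 1..M. X (m - M + i) - pre_fit ab (real (m - M + i) / real n)))"

definition K_stat :: "nat \<Rightarrow> nat \<Rightarrow> real \<times> real \<Rightarrow> (nat \<Rightarrow> real) \<Rightarrow> nat \<Rightarrow> real" where
  "K_stat n N ab X m =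
     (let M = window N m in
      6 / (real M * (real M + 1) * (2 * real M + 1)) *
      (\<Sum>i = 1..M. real i * (X (m - M + i) - pre_fit ab (real (m - M + i) / real n))))"

definition detection_time :: "nat \<Rightarrow> nat \<Rightarrow> real \<Rightarrow> (nat \<Rightarrow> real) \<Rightarrow> real" where
  "detection_time n k \<rho> T =
     (if \<exists>m. k < m \<and> m \<le> n \<and> \<bar>T m\<bar> \<ge> \<rho>
      then real (Min {m. \<bar>T m\<bar> \<ge> \<rho> \<and> k < m \<and> m \<le> n}) / real n else 1)"

definition floc_detector ::
    "nat \<Rightarrow> nat \<Rightarrow> nat \<Rightarrow> nat \<Rightarrow> real \<Rightarrow> real \<Rightarrow> real \<times> real \<Rightarrow> (nat \<Rightarrow> real) \<Rightarrow> real" where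
  "floc_detector n k N_J N_K \<rho>_J \<rho>_K ab X =
     min (detection_time n k \<rho>_J (J_stat n N_J ab X)) (detection_time n k \<rho>_K (K_stat n N_K ab X))"


section \<open>A unit-cost random access machine over the reals\<close>

text \<open>
  The machine has two unbounded memories, one for indices (natural numbers) and one for real data.
  A cell that has never been written holds no number (\<^const>\<open>None\<close>); reading it, or dividing by
  zero, blocks execution.  Both memories may be addressed indirectly through an index cell.
  Real numbers influence indices only through comparisons: there is no rounding of
  reals, so that several reals cannot be packed into one cell and cheaply extracted again. The only
  constants are natural numbers.
\<close>

record store =
  idx :: "nat \<rightharpoonup> nat"
  dat :: "nat \<rightharpoonup> real"

datatype addr = Dir nat | Ind nat

fun address :: "addr \<Rightarrow> store \<Rightarrow> nat option" where
  "address (Dir a) s = Some a"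
| "address (Ind a) s = idx s a"

definition get_idx :: "addr \<Rightarrow> store \<Rightarrow> nat option" where
  "get_idx a s = do { l \<leftarrow> address a s; idx s l }"

definition get_dat :: "addr \<Rightarrow> store \<Rightarrow> real option" where
  "get_dat a s = do { l \<leftarrow> address a s; dat s l }"

definition put_idx :: "addr \<Rightarrow> nat \<Rightarrow> store \<Rightarrow> store option" where
  "put_idx a x s = do { l \<leftarrow> address a s; Some (s\<lparr>idx := (idx s)(l \<mapsto> x)\<rparr>) }"

definition put_dat :: "addr \<Rightarrow> real \<Rightarrow> store \<Rightarrow> store option" where
  "put_dat a x s = do { l \<leftarrow> address a s; Some (s\<lparr>dat := (dat s)(l \<mapsto> x)\<rparr>) }"

datatype iop = IAdd | ISub | IMul | IDiv | IMod

datatype rop = RAdd | RSub | RMul | RDiv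

text \<open>\<^const>\<open>ISub\<close> is truncated subtraction of natural numbers.\<close>

fun eval_iop :: "iop \<Rightarrow> nat \<Rightarrow> nat \<Rightarrow> nat option" where
  "eval_iop IAdd x y = Some (x + y)"
| "eval_iop ISub x y = Some (x - y)"
| "eval_iop IMul x y = Some (x * y)"
| "eval_iop IDiv x y = (if y = 0 then None else Some (x div y))"
| "eval_iop IMod x y = (if y = 0 then None else Some (x mod y))"

fun eval_rop :: "rop \<Rightarrow> real \<Rightarrow> real \<Rightarrow> real option" where
  "eval_rop RAdd x y = Some (x + y)"
| "eval_rop RSub x y = Some (x - y)"
| "eval_rop RMul x y = Some (x * y)"
| "eval_rop RDiv x y = (if y = 0 then None else Some (x / y))"

text \<open>The first address of each instruction is its destination; \<open>RofI\<close> converts an index to a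
  real number.\<close>

datatype instr =
    IConst addr nat
  | IMove addr addr
  | IOp iop addr addr addr
  | RofI addr addr
  | RMove addr addr
  | ROp rop addr addr addr

fun run_instr :: "instr \<Rightarrow> store \<Rightarrow> store option" where
  "run_instr (IConst d c) s = put_idx d c s"
| "run_instr (IMove d a) s = do { x \<leftarrow> get_idx a s; put_idx d x s }"
| "run_instr (IOp f d a b) s =
     do { x \<leftarrow> get_idx a s; y \<leftarrow> get_idx b s; z \<leftarrow> eval_iop f x y; put_idx d z s }"
| "run_instr (RofI d a) s = do { x \<leftarrow> get_idx a s; put_dat d (real x) s }"
| "run_instr (RMove d a) s = do { x \<leftarrow> get_dat a s; put_dat d x s }"
| "run_instr (ROp f d a b) s =
     do { x \<leftarrow> get_dat a s; y \<leftarrow> get_dat b s; z \<leftarrow> eval_rop f x y; put_dat d z s }"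

datatype test = ILess addr addr | RLess addr addr

fun run_test :: "test \<Rightarrow> store \<Rightarrow> bool option" where
  "run_test (ILess a b) s = do { x \<leftarrow> get_idx a s; y \<leftarrow> get_idx b s; Some (x < y) }"
| "run_test (RLess a b) s = do { x \<leftarrow> get_dat a s; y \<leftarrow> get_dat b s; Some (x < y) }"

datatype prog =
    Skip
  | Do instr
  | Seq prog prog
  | If test prog prog
  | While test prog

text \<open>\<open>exec p s t s'\<close>: started in \<open>s\<close>, the program \<open>p\<close> terminates in \<open>s'\<close> after exactly \<open>t\<close>
  instructions and comparisons.\<close>

inductive exec :: "prog \<Rightarrow> store \<Rightarrow> nat \<Rightarrow> store \<Rightarrow> bool" where
  Skip: "exec Skip s 0 s"
| Do: "run_instr i s = Some s' \<Longrightarrow> exec (Do i) s 1 s'"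
| Seq: "exec p s t s' \<Longrightarrow> exec q s' u s'' \<Longrightarrow> exec (Seq p q) s (t + u) s''"
| IfTrue: "run_test b s = Some True \<Longrightarrow> exec p s t s' \<Longrightarrow> exec (If b p q) s (1 + t) s'"
| IfFalse: "run_test b s = Some False \<Longrightarrow> exec q s t s' \<Longrightarrow> exec (If b p q) s (1 + t) s'"
| WhileFalse: "run_test b s = Some False \<Longrightarrow> exec (While b p) s 1 s"
| WhileTrue: "run_test b s = Some True \<Longrightarrow> exec p s t s' \<Longrightarrow> exec (While b p) s' u s'' \<Longrightarrow>
    exec (While b p) s (1 + t + u) s''"

text \<open>The number of cells that hold a number. Cells are never released, so this quantity, taken at
  the end of a run, is also its maximum over the run (see \<open>exec_storage_mono\<close> below).\<close>

definition storage :: "store \<Rightarrow> nat" where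
  "storage s = card (dom (idx s)) + card (dom (dat s))"

definition finite_store :: "store \<Rightarrow> bool" where
  "finite_store s \<longleftrightarrow> finite (dom (idx s)) \<and> finite (dom (dat s))"

lemma run_instr_dom:
  assumes "run_instr i s = Some s'"
  shows "dom (idx s) \<subseteq> dom (idx s') \<and> dom (dat s) \<subseteq> dom (dat s') \<and>
    (finite_store s \<longrightarrow> finite_store s')"
  using assms
  by (cases i) (auto simp: put_idx_def put_dat_def finite_store_def Option.bind_eq_Some_conv)

lemma exec_dom:
  assumes "exec p s t s'"
  shows "dom (idx s) \<subseteq> dom (idx s') \<and> dom (dat s) \<subseteq> dom (dat s') \<and>
    (finite_store s \<longrightarrow> finite_store s')"
  using assms
proof (induction rule: exec.induct)
  case Do
  then show ?case by (rule run_instr_dom)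
qed (simp_all add: subset_iff)

lemma exec_storage_mono:
  assumes "exec p s t s'" "finite_store s"
  shows "storage s \<le> storage s'" "finite_store s'"
  using exec_dom[OF assms(1)] assms(2)
  by (auto simp: storage_def finite_store_def intro!: add_mono card_mono)

inductive_cases exec_SkipE: "exec Skip s t s'"
inductive_cases exec_DoE: "exec (Do i) s t s'"
inductive_cases exec_SeqE: "exec (Seq p q) s t s'"
inductive_cases exec_IfE: "exec (If b p q) s t s'"
inductive_cases exec_WhileE: "exec (While b p) s t s'"

lemma exec_deterministic:
  assumes "exec p s t s'" "exec p s u s''"
  shows "t = u \<and> s' = s''"
  using assms
proof (induction arbitrary: u s'' rule: exec.induct)
  case Skip
  from Skip.prems show ?case by (rule exec_SkipE) simp
next
  case Do
  from Do.prems show ?case by (rule exec_DoE) (use Do.hyps in auto)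
next
  case (Seq p s t s1 q v s2)
  from Seq.prems obtain t' v' r where "exec p s t' r" "exec q r v' s''" "u = t' + v'"
    by (rule exec_SeqE)
  then show ?case using Seq.IH(1)[of t' r] Seq.IH(2)[of v' s''] by simp
next
  case (IfTrue b s p t s1)
  from IfTrue.prems obtain t' where "exec p s t' s''" "u = 1 + t'"
    by (rule exec_IfE) (use IfTrue.hyps(1) in simp_all)
  then show ?case using IfTrue.IH[of t' s''] by simp
next
  case (IfFalse b s q t s1)
  from IfFalse.prems obtain t' where "exec q s t' s''" "u = 1 + t'"
    by (rule exec_IfE) (use IfFalse.hyps(1) in simp_all)
  then show ?case using IfFalse.IH[of t' s''] by simp
next
  case WhileFalse
  from WhileFalse.prems show ?case by (rule exec_WhileE) (use WhileFalse.hyps in auto)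
next
  case (WhileTrue b s p t s1 v s2)
  from WhileTrue.prems obtain t' v' r where
    "exec p s t' r" "exec (While b p) r v' s''" "u = 1 + t' + v'"
    by (rule exec_WhileE) (use WhileTrue.hyps(1) in simp_all)
  then show ?case using WhileTrue.IH(1)[of t' r] WhileTrue.IH(2)[of v' s''] by simp
qed


section \<open>Streaming algorithms\<close>

text \<open>The program \<open>init\<close> runs once on the input parameters, before the first observation; the
  program \<open>step\<close> runs once upon arrival of each observation. Neither depends on the parameters.\<close>

record stream_alg =
  init :: prog
  step :: prog

text \<open>Interface cells: \<open>n, k, N_J, N_K\<close> in index cells 0 to 3 and the two coefficients and two
  thresholds in data cells 0 to 3; the arriving observation is placed in data cell 4. The
  decision is left in index cell 4, the value of the detector in data cell 5.\<close>

definition input_store :: "nat \<Rightarrow> nat \<Rightarrow> nat \<Rightarrow> nat \<Rightarrow> real \<times> real \<Rightarrow> real \<Rightarrow> real \<Rightarrow> store" where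
  "input_store n k N_J N_K ab \<rho>_J \<rho>_K =
     \<lparr>idx = [0 \<mapsto> n, 1 \<mapsto> k, 2 \<mapsto> N_J, 3 \<mapsto> N_K],
      dat = [0 \<mapsto> fst ab, 1 \<mapsto> snd ab, 2 \<mapsto> \<rho>_J, 3 \<mapsto> \<rho>_K]\<rparr>"

definition feed :: "real \<Rightarrow> store \<Rightarrow> store" where
  "feed x s = s\<lparr>dat := (dat s)(4 \<mapsto> x)\<rparr>"

definition decision :: "store \<Rightarrow> nat option" where
  "decision s = idx s 4"

definition detector_output :: "store \<Rightarrow> real option" where
  "detector_output s = dat s 5"

text \<open>\<open>S m\<close> is the store after \<open>X\<^sub>m\<close> has been processed and \<open>T m\<close> the time spent on \<open>X\<^sub>m\<close>;
  \<open>S 0\<close> and \<open>T 0\<close> refer to the initialisation. Both are uniquely determined up to \<open>n\<close>, by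
  \<open>exec_deterministic\<close>.\<close>

definition stream_run ::
    "stream_alg \<Rightarrow> store \<Rightarrow> (nat \<Rightarrow> real) \<Rightarrow> nat \<Rightarrow> (nat \<Rightarrow> store) \<Rightarrow> (nat \<Rightarrow> nat) \<Rightarrow> bool" where
  "stream_run A s X n S T \<longleftrightarrow>
     exec (init A) s (T 0) (S 0) \<and>
     (\<forall>m\<in>{1..n}. exec (step A) (feed (X m) (S (m - 1))) (T m) (S m))"

end

(* Every window of length window N m ending at m starts right after the multiple (m div N - 2) * N
   of N. Hence, with P and Q the cumulative sums of the residuals e i and of i * e i, both statistics
   are functions of m, P m, Q m and of P and Q at the start a of the window: the sums in question are
   P m - P a and (Q m - Q a) - a * (P m - P a). As a takes a new value only when N divides m, it
   suffices to keep the values of P and Q at the last three multiples of N. *)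

theory Submission
  imports Defs
begin

section \<open>Windowed sums from cumulative sums\<close>

text \<open>The start of the \<open>j\<close>-th last bin; by truncated subtraction it is 0 as long as there are
  fewer than \<open>j\<close> complete bins, so that the differences of cumulative sums need no case
  distinction.\<close>

definition bin_start :: "nat \<Rightarrow> nat \<Rightarrow> nat \<Rightarrow> nat" where
  "bin_start N j m = (m div N - j) * N"

lemma bin_start_0 [simp]: "bin_start N j 0 = 0"
  by (simp add: bin_start_def)

text \<open>\<open>m div N\<close> grows by one exactly when \<open>N\<close> divides
  \<open>Suc m\<close>, and this unit cancels against \<open>Suc j\<close>. So the bin starts move
  like a shift register, whose newest entry \<open>bin_start_0_Suc\<close> supplies.\<close>

lemma bin_start_Suc:
  "bin_start N (Suc j) (Suc m) =
     (if Suc m mod N = 0 then bin_start N j m else bin_start N (Suc j) m)"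
  by (simp add: bin_start_def div_Suc)

lemma bin_start_0_Suc:
  "bin_start N 0 (Suc m) = (if Suc m mod N = 0 then Suc m else bin_start N 0 m)"
  using div_mult_mod_eq[of "Suc m" N] by (auto simp: bin_start_def div_Suc)

lemma diff_window: "m - window N m = bin_start N 2 m"
proof -
  have "m - window N m = (m div N * N + m mod N) - (2 * N + m mod N)"
    by (simp add: window_def)
  also have "\<dots> = bin_start N 2 m"
    by (simp only: bin_start_def diff_mult_distrib diff_cancel2)
  finally show ?thesis .
qed

definition cumsum :: "(nat \<Rightarrow> real) \<Rightarrow> nat \<Rightarrow> real" where
  "cumsum f m = (\<Sum>i = 1..m. f i)"

lemma cumsum_0 [simp]: "cumsum f 0 = 0"
  by (simp add: cumsum_def)

lemma cumsum_Suc: "cumsum f (Suc m) = cumsum f m + f (Suc m)"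
  by (simp add: cumsum_def)

lemma sum_shift_cumsum: "(\<Sum>i = 1..M. f (a + i)) = cumsum f (a + M) - cumsum f a"
  by (induction M) (simp_all add: cumsum_Suc)

definition resid :: "nat \<Rightarrow> real \<times> real \<Rightarrow> (nat \<Rightarrow> real) \<Rightarrow> nat \<Rightarrow> real" where
  "resid n ab X i = X i - pre_fit ab (real i / real n)"

lemma J_stat_cumsum:
  assumes "window N m \<le> m"
  shows "J_stat n N ab X m =
    (cumsum (resid n ab X) m - cumsum (resid n ab X) (bin_start N 2 m)) / real (window N m)"
proof -
  \<comment> \<open>The hypothesis makes the truncated difference in \<open>diff_window\<close>
    exact.\<close>
  have "bin_start N 2 m + window N m = m"
    using assms diff_window[of m N] by simp
  then show ?thesis
    using sum_shift_cumsum[of "resid n ab X" "bin_start N 2 m" "window N m"]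
    by (simp add: J_stat_def Let_def resid_def diff_window)
qed

text \<open>The weight relative to the window is \<open>(a + i) - a\<close>, so one product with
  \<open>a\<close> corrects the sums with absolute weights. The placement of 6 and the factor
  \<open>real M + 1 + real M\<close> follow the operations of \<open>compute_K\<close>.\<close>

lemma K_stat_cumsum:
  fixes n N m :: nat and ab :: "real \<times> real" and X :: "nat \<Rightarrow> real"
  defines "P \<equiv> cumsum (resid n ab X)" and "Q \<equiv> cumsum (\<lambda>i. real i * resid n ab X i)"
    and "M \<equiv> window N m" and "a \<equiv> bin_start N 2 m"
  assumes "window N m \<le> m"
  shows "K_stat n N ab X m =
    6 * ((Q m - Q a - real a * (P m - P a)) / (real M * (real M + 1) * (real M + 1 + real M)))"
proof -
  let ?e = "resid n ab X"
  have a: "a = m - M" "a + M = m"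
    using assms diff_window[of m N] by auto
  have "(\<Sum>i = 1..M. real i * ?e (a + i)) =
      (\<Sum>i = 1..M. real (a + i) * ?e (a + i) - real a * ?e (a + i))"
    by (simp add: algebra_simps)
  also have "\<dots> = Q m - Q a - real a * (P m - P a)"
    using sum_shift_cumsum[of ?e a M] sum_shift_cumsum[of "\<lambda>i. real i * ?e i" a M] a(2)
    by (simp add: sum_subtractf P_def Q_def flip: sum_distrib_left)
  finally have "(\<Sum>i = 1..M. real i * ?e (m - M + i)) = Q m - Q a - real a * (P m - P a)"
    by (simp add: a(1))
  then have "K_stat n N ab X m =
      6 / (real M * (real M + 1) * (2 * real M + 1)) * (Q m - Q a - real a * (P m - P a))"
    by (simp only: K_stat_def Let_def resid_def M_def)
  then show ?thesis
    by (simp only: times_divide_eq_left times_divide_eq_right mult_2 add_ac)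
qed


section \<open>The running detection time\<close>

text \<open>The inserted 1 is the default without an alarm and keeps the set nonempty; for
  \<open>m \<le> n\<close> it is otherwise harmless, since all ratios are at most 1. In this form a
  single \<open>min\<close> per alarm updates the value.\<close>

definition first_alarm :: "nat \<Rightarrow> nat \<Rightarrow> (nat \<Rightarrow> bool) \<Rightarrow> nat \<Rightarrow> real" where
  "first_alarm n k A m = Min (insert 1 ((\<lambda>i. real i / real n) ` {i. k < i \<and> i \<le> m \<and> A i}))"

lemma first_alarm_0: "first_alarm n k A 0 = 1"
proof -
  have none: "{i. k < i \<and> i \<le> 0 \<and> A i} = {}"
    by auto
  show ?thesis
    unfolding first_alarm_def none by simp
qed

lemma first_alarm_Suc:
  "first_alarm n k A (Suc m) =
     (if k < Suc m \<and> A (Suc m) then min (real (Suc m) / real n) (first_alarm n k A m)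
      else first_alarm n k A m)"
proof -
  have "{i. k < i \<and> i \<le> Suc m \<and> A i} =
      (if k < Suc m \<and> A (Suc m) then insert (Suc m) {i. k < i \<and> i \<le> m \<and> A i}
       else {i. k < i \<and> i \<le> m \<and> A i})"
    by (auto simp: le_Suc_eq)
  then show ?thesis
    by (simp add: first_alarm_def insert_commute[of 1 "real (Suc m) / real n"] del: of_nat_Suc)
qed

lemma detection_time_first_alarm:
  assumes "0 < n"
  shows "detection_time n k \<rho> T = first_alarm n k (\<lambda>m. \<bar>T m\<bar> \<ge> \<rho>) n"
proof (cases "\<exists>m. k < m \<and> m \<le> n \<and> \<bar>T m\<bar> \<ge> \<rho>")
  case True
  let ?S = "{m. k < m \<and> m \<le> n \<and> \<bar>T m\<bar> \<ge> \<rho>}"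
  have S: "finite ?S" "?S \<noteq> {}"
    using True by auto
  have "real (Min ?S) / real n = Min ((\<lambda>i. real i / real n) ` ?S)"
    using S by (intro mono_Min_commute) (auto intro!: monoI divide_right_mono)
  moreover have "Min ((\<lambda>i. real i / real n) ` ?S) \<le> 1"
    using S assms by (subst Min_le_iff) auto
  ultimately show ?thesis
    using S True by (simp add: detection_time_def first_alarm_def conj_ac)
next
  case False
  then have "{m. k < m \<and> m \<le> n \<and> \<bar>T m\<bar> \<ge> \<rho>} = {}"
    by auto
  with False show ?thesis
    by (simp only: detection_time_def first_alarm_def if_False image_empty Min_singleton)
qed

text \<open>The alarm set of a disjunction is a union, whose minimum is the smaller of the two
  minima. Hence a single cell can hold the FLOC output.\<close>

lemma first_alarm_disj:
  "first_alarm n k (\<lambda>m. A m \<or> B m) m = min (first_alarm n k A m) (first_alarm n k B m)"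
proof (induction m)
  case (Suc m)
  then show ?case
    by (cases "k < Suc m"; cases "A (Suc m)"; cases "B (Suc m)")
      (simp_all only: first_alarm_Suc simp_thms if_True if_False min.assoc min.commute
        min.left_commute min.left_idem)
qed (simp add: first_alarm_0)


section \<open>Weakest preconditions\<close>

text \<open>Termination without blocking is included, but the time is hidden:
  \<open>exec_cost\<close> bounds it separately, from the syntax.\<close>

definition wp :: "prog \<Rightarrow> (store \<Rightarrow> bool) \<Rightarrow> store \<Rightarrow> bool" where
  "wp p Q s \<longleftrightarrow> (\<exists>t s'. exec p s t s' \<and> Q s')"

lemma wp_mono: "wp p Q s \<Longrightarrow> (\<And>r. Q r \<Longrightarrow> R r) \<Longrightarrow> wp p R s"
  by (auto simp: wp_def)

lemma wp_Skip [simp]: "wp Skip Q s \<longleftrightarrow> Q s"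
  by (auto simp: wp_def intro: exec.Skip elim: exec_SkipE)

lemma wp_Do [simp]: "wp (Do i) Q s \<longleftrightarrow> (case run_instr i s of None \<Rightarrow> False | Some r \<Rightarrow> Q r)"
  by (auto simp: wp_def split: option.split intro: exec.Do elim!: exec_DoE)

lemma wp_Seq [simp]: "wp (Seq p q) Q s \<longleftrightarrow> wp p (wp q Q) s"
  unfolding wp_def by (blast intro: exec.Seq elim: exec_SeqE)

lemma wp_If [simp]:
  "wp (If b p q) Q s \<longleftrightarrow>
     (case run_test b s of None \<Rightarrow> False | Some c \<Rightarrow> if c then wp p Q s else wp q Q s)"
proof (cases "run_test b s")
  case None
  then show ?thesis
    by (auto simp: wp_def elim!: exec_IfE)
next
  case (Some c)
  then show ?thesis
    unfolding wp_def by (cases c) (auto elim!: exec_IfE dest: exec.IfTrue exec.IfFalse)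
qed

fun loop_free :: "prog \<Rightarrow> bool" where
  "loop_free (Seq p q) \<longleftrightarrow> loop_free p \<and> loop_free q"
| "loop_free (If b p q) \<longleftrightarrow> loop_free p \<and> loop_free q"
| "loop_free (While b p) \<longleftrightarrow> False"
| "loop_free _ \<longleftrightarrow> True"

text \<open>Branches are charged the costlier arm. The catch-all value 0 is exact for
  \<open>Skip\<close> and a dummy for loops, which \<open>exec_cost\<close> excludes.\<close>

fun cost :: "prog \<Rightarrow> nat" where
  "cost (Do i) = 1"
| "cost (Seq p q) = cost p + cost q"
| "cost (If b p q) = 1 + max (cost p) (cost q)"
| "cost _ = 0"

lemma exec_cost:
  assumes "exec p s t s'" "loop_free p"
  shows "t \<le> cost p"
  using assms by (induction rule: exec.induct) auto

primrec instrs :: "instr list \<Rightarrow> prog" where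
  "instrs [] = Skip"
| "instrs (i # is) = Seq (Do i) (instrs is)"

lemma loop_free_instrs [simp]: "loop_free (instrs is)"
  by (induction "is") simp_all


section \<open>The streaming algorithm\<close>

text \<open>Index cell 5 holds the number of observations seen so far. Data cells 6 and 7 hold the
  cumulative sums \<open>P\<close> of the residuals and \<open>Q\<close> of the residuals times their index; cells
  8 to 10 hold \<open>P\<close> at the last three bin starts for \<open>N\<^sub>J\<close>, cells 11 to 13 and 14 to 16 hold
  \<open>P\<close> and \<open>Q\<close> at those for \<open>N\<^sub>K\<close>. Index cells 6 to 8 and data cells 17 to 20 are scratch.\<close>

definition init_prog :: prog where
  "init_prog =
     Seq (instrs [IConst (Dir 4) 0, IConst (Dir 5) 0])
    (Seq (instrs (map (\<lambda>j. RofI (Dir j) (Dir 4)) [4..<17]))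
         (instrs [IConst (Dir 6) 1, RofI (Dir 5) (Dir 6)]))"

definition accumulate :: prog where
  "accumulate = instrs
    [IConst (Dir 6) 1,
     IOp IAdd (Dir 5) (Dir 5) (Dir 6),
     RofI (Dir 17) (Dir 5),
     RofI (Dir 18) (Dir 0),
     ROp RDiv (Dir 18) (Dir 17) (Dir 18),
     ROp RMul (Dir 18) (Dir 1) (Dir 18),
     ROp RAdd (Dir 18) (Dir 0) (Dir 18),
     ROp RSub (Dir 18) (Dir 4) (Dir 18),
     ROp RAdd (Dir 6) (Dir 6) (Dir 18),
     ROp RMul (Dir 18) (Dir 17) (Dir 18),
     ROp RAdd (Dir 7) (Dir 7) (Dir 18)]"

text \<open>Cell \<open>c\<close> holds the bin size, cell \<open>p\<close> a cumulative sum, and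
  \<open>b\<close> starts a register of three cells, oldest first. Tests are strict comparisons, so
  divisibility is the failure of 0 < remainder.\<close>

definition shift_bins :: "nat \<Rightarrow> nat \<Rightarrow> nat \<Rightarrow> prog" where
  "shift_bins c p b = Seq
    (instrs [IOp IMod (Dir 6) (Dir 5) (Dir c), IConst (Dir 7) 0])
    (If (ILess (Dir 7) (Dir 6)) Skip
      (instrs [RMove (Dir b) (Dir (b + 1)), RMove (Dir (b + 1)) (Dir (b + 2)),
               RMove (Dir (b + 2)) (Dir p)]))"

definition window_length :: "nat \<Rightarrow> prog" where
  "window_length c = instrs
    [IOp IMod (Dir 6) (Dir 5) (Dir c),
     IConst (Dir 7) 2,
     IOp IMul (Dir 7) (Dir 7) (Dir c),
     IOp IAdd (Dir 6) (Dir 7) (Dir 6),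
     RofI (Dir 17) (Dir 6)]"

definition compute_J :: prog where
  "compute_J = instrs
    [ROp RSub (Dir 18) (Dir 6) (Dir 8),
     ROp RDiv (Dir 18) (Dir 18) (Dir 17)]"

text \<open>Data cells 11 and 14 hold \<open>P\<close> and \<open>Q\<close> at the window start,
  whose position is the current time minus the window length. The constants 1 and 6 become reals by
  way of index cell 7.\<close>

definition compute_K :: prog where
  "compute_K = instrs
    [ROp RSub (Dir 18) (Dir 6) (Dir 11),
     IOp ISub (Dir 7) (Dir 5) (Dir 6),
     RofI (Dir 19) (Dir 7),
     ROp RMul (Dir 18) (Dir 19) (Dir 18),
     ROp RSub (Dir 19) (Dir 7) (Dir 14),
     ROp RSub (Dir 18) (Dir 19) (Dir 18),
     IConst (Dir 7) 1,
     RofI (Dir 19) (Dir 7),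
     ROp RAdd (Dir 19) (Dir 17) (Dir 19),
     ROp RAdd (Dir 20) (Dir 19) (Dir 17),
     ROp RMul (Dir 19) (Dir 17) (Dir 19),
     ROp RMul (Dir 19) (Dir 19) (Dir 20),
     ROp RDiv (Dir 18) (Dir 18) (Dir 19),
     IConst (Dir 7) 6,
     RofI (Dir 19) (Dir 7),
     ROp RMul (Dir 18) (Dir 19) (Dir 18)]"

text \<open>The condition \<open>\<bar>y\<bar> \<ge> r\<close> fails exactly when both
  \<open>y\<close> and \<open>-y\<close> lie below \<open>r\<close>. The decision cell is only ever
  set to 1 here, so consecutive tests form a disjunction.\<close>

definition raise_alarm :: "nat \<Rightarrow> prog" where
  "raise_alarm r = Seq
    (instrs [IConst (Dir 7) 0, RofI (Dir 17) (Dir 7), ROp RSub (Dir 17) (Dir 17) (Dir 18)])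
    (If (RLess (Dir 18) (Dir r))
      (If (RLess (Dir 17) (Dir r)) Skip (Do (IConst (Dir 4) 1)))
      (Do (IConst (Dir 4) 1)))"

definition update_output :: prog where
  "update_output = Seq (Do (IConst (Dir 7) 0))
    (If (ILess (Dir 7) (Dir 4))
      (Seq
        (instrs [RofI (Dir 17) (Dir 5), RofI (Dir 18) (Dir 0),
                 ROp RDiv (Dir 17) (Dir 17) (Dir 18)])
        (If (RLess (Dir 17) (Dir 5)) (Do (RMove (Dir 5) (Dir 17))) Skip))
      Skip)"

definition decide :: prog where
  "decide = Seq (Do (IConst (Dir 4) 0))
    (If (ILess (Dir 1) (Dir 5))
      (Seq (Seq (window_length 2) (Seq compute_J (raise_alarm 2)))
      (Seq (Seq (window_length 3) (Seq compute_K (raise_alarm 3)))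
           update_output))
      Skip)"

text \<open>The order matters: at a multiple of the bin size the newest register entry includes the
  current observation, and the tests read the shifted registers. \<open>J_stat\<close> needs only
  \<open>P\<close>, so three registers suffice.\<close>

definition step_prog :: prog where
  "step_prog = Seq accumulate
    (Seq (shift_bins 2 6 8) (Seq (shift_bins 3 6 11) (Seq (shift_bins 3 7 14) decide)))"

text \<open>Quantifying over the non-scratch cells only builds the frame condition into the
  specification of each program.\<close>

definition rep :: "(nat \<Rightarrow> nat) \<Rightarrow> (nat \<Rightarrow> real) \<Rightarrow> store \<Rightarrow> bool" where
  "rep u v s \<longleftrightarrow> (\<forall>i\<le>5. idx s i = Some (u i)) \<and> (\<forall>j\<le>16. dat s j = Some (v j)) \<and>
     dom (idx s) \<subseteq> {..8} \<and> dom (dat s) \<subseteq> {..20}"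

section \<open>Effect of the program fragments on the memory\<close>

lemmas exec_simps = get_idx_def get_dat_def put_idx_def put_dat_def

lemma rep_feed: "rep u v s \<Longrightarrow> rep u (v(4 := x)) (feed x s)"
  by (auto simp: rep_def feed_def)

text \<open>Data cell 4 is zeroed too, since \<open>rep\<close> requires every data cell up to 16 to
  be filled even before the first observation; cell 5 starts at the default output 1.\<close>

lemma init_prog_wp:
  "wp init_prog (rep (\<lambda>i. [n, k, N_J, N_K, 0, 0] ! i)
      (\<lambda>j. if j < 4 then [fst ab, snd ab, \<rho>_J, \<rho>_K] ! j else if j = 5 then 1 else 0))
    (input_store n k N_J N_K ab \<rho>_J \<rho>_K)"
proof -
  have le: "(\<forall>i\<le>k. P i) \<longleftrightarrow> list_all P [0..<Suc k]" for k P
    by (auto simp: list_all_iff less_Suc_eq_le)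
  show ?thesis
    unfolding rep_def le
    by (auto simp: init_prog_def input_store_def exec_simps upt_rec)
qed

lemma accumulate_wp:
  assumes "rep u v s" "0 < u 0"
  shows "wp accumulate
    (rep (u(5 := Suc (u 5)))
      (let e = v 4 - (v 0 + v 1 * (real (Suc (u 5)) / real (u 0)))
       in v(6 := v 6 + e, 7 := v 7 + real (Suc (u 5)) * e))) s"
  using assms by (simp add: accumulate_def rep_def exec_simps Let_def)

text \<open>The condition \<open>p < b\<close> keeps the source of the last move outside the
  register being shifted.\<close>

lemma shift_bins_wp:
  assumes "rep u v s" "0 < u c" "c \<le> 5" "p \<le> 16" "b + 2 \<le> 16" "p < b"
  shows "wp (shift_bins c p b)
    (rep u (if u 5 mod u c = 0 then v(b := v (b + 1), b + 1 := v (b + 2), b + 2 := v p) else v)) s"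
  using assms by (auto simp: shift_bins_def rep_def exec_simps)

lemma window_length_wp:
  assumes "rep u v s" "0 < u c" "c \<le> 5"
  shows "wp (window_length c) (\<lambda>s. rep u v s \<and>
    idx s 6 = Some (window (u c) (u 5)) \<and> dat s 17 = Some (real (window (u c) (u 5)))) s"
  using assms by (auto simp: window_length_def window_def rep_def exec_simps)

lemma compute_J_wp:
  assumes "rep u v s" "dat s 17 = Some (real M)" "0 < M"
  shows "wp compute_J (\<lambda>s. rep u v s \<and> dat s 18 = Some ((v 6 - v 8) / real M)) s"
  using assms by (auto simp: compute_J_def rep_def exec_simps)

lemma compute_K_wp:
  assumes "rep u v s" "idx s 6 = Some M" "dat s 17 = Some (real M)" "0 < M"
  shows "wp compute_K (\<lambda>s. rep u v s \<and> dat s 18 = Some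
    (6 * ((v 7 - v 14 - real (u 5 - M) * (v 6 - v 11)) /
      (real M * (real M + 1) * (real M + 1 + real M))))) s"
  using assms by (auto simp: compute_K_def rep_def exec_simps)

lemma raise_alarm_wp:
  assumes "rep u v s" "dat s 18 = Some y" "r \<le> 16"
  shows "wp (raise_alarm r) (rep (u(4 := if \<bar>y\<bar> \<ge> v r then 1 else u 4)) v) s"
  using assms by (auto simp: raise_alarm_def rep_def exec_simps)

lemma update_output_wp:
  assumes "rep u v s" "0 < u 0"
  shows "wp update_output
    (rep u (if 0 < u 4 then v(5 := min (real (u 5) / real (u 0)) (v 5)) else v)) s"
  using assms by (auto simp: update_output_def rep_def exec_simps)

lemma window_pos: "0 < N \<Longrightarrow> 0 < window N m"
  by (simp add: window_def)

lemma test_J_wp: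
  assumes "rep u v s" "0 < u 2"
  defines "J \<equiv> (v 6 - v 8) / real (window (u 2) (u 5))"
  shows "wp (Seq (window_length 2) (Seq compute_J (raise_alarm 2)))
    (rep (u(4 := if \<bar>J\<bar> \<ge> v 2 then 1 else u 4)) v) s"
  unfolding wp_Seq
proof (rule wp_mono[OF window_length_wp[OF assms(1)]])
  fix r
  assume r: "rep u v r \<and> idx r 6 = Some (window (u 2) (u 5)) \<and>
    dat r 17 = Some (real (window (u 2) (u 5)))"
  have "wp compute_J (\<lambda>s. rep u v s \<and> dat s 18 = Some J) r"
    unfolding J_def by (rule compute_J_wp) (use r assms(2) in \<open>simp_all add: window_pos\<close>)
  then show "wp compute_J (wp (raise_alarm 2) (rep (u(4 := if \<bar>J\<bar> \<ge> v 2 then 1 else u 4)) v)) r"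
    by (rule wp_mono) (elim conjE, rule raise_alarm_wp, assumption+, simp)
qed (use assms(2) in simp_all)

lemma test_K_wp:
  assumes "rep u v s" "0 < u 3"
  defines "M \<equiv> window (u 3) (u 5)"
  defines "K \<equiv> 6 * ((v 7 - v 14 - real (u 5 - M) * (v 6 - v 11)) /
    (real M * (real M + 1) * (real M + 1 + real M)))"
  shows "wp (Seq (window_length 3) (Seq compute_K (raise_alarm 3)))
    (rep (u(4 := if \<bar>K\<bar> \<ge> v 3 then 1 else u 4)) v) s"
  unfolding wp_Seq
proof (rule wp_mono[OF window_length_wp[OF assms(1)]])
  fix r
  assume r: "rep u v r \<and> idx r 6 = Some (window (u 3) (u 5)) \<and>
    dat r 17 = Some (real (window (u 3) (u 5)))"
  have "wp compute_K (\<lambda>s. rep u v s \<and> dat s 18 = Some K) r"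
    unfolding K_def by (rule compute_K_wp) (use r assms(2) in \<open>simp_all add: window_pos M_def\<close>)
  then show "wp compute_K (wp (raise_alarm 3) (rep (u(4 := if \<bar>K\<bar> \<ge> v 3 then 1 else u 4)) v)) r"
    by (rule wp_mono) (elim conjE, rule raise_alarm_wp, assumption+, simp)
qed (use assms(2) in simp_all)

lemma decide_wp:
  assumes rep: "rep u v s" and pos: "0 < u 0" "0 < u 2" "0 < u 3"
  defines "M \<equiv> window (u 3) (u 5)"
  defines "J \<equiv> (v 6 - v 8) / real (window (u 2) (u 5))"
    and "K \<equiv> 6 * ((v 7 - v 14 - real (u 5 - M) * (v 6 - v 11)) /
      (real M * (real M + 1) * (real M + 1 + real M)))"
  defines "A \<equiv> u 1 < u 5 \<and> (\<bar>J\<bar> \<ge> v 2 \<or> \<bar>K\<bar> \<ge> v 3)"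
  shows "wp decide
    (rep (u(4 := if A then 1 else 0))
      (if A then v(5 := min (real (u 5) / real (u 0)) (v 5)) else v)) s" (is "wp _ ?Q _")
proof -
  define u0 where "u0 = u(4 := 0)"
  define u1 where "u1 = u0(4 := if \<bar>J\<bar> \<ge> v 2 then 1 else u0 4)"
  define u2 where "u2 = u1(4 := if \<bar>K\<bar> \<ge> v 3 then 1 else u1 4)"
  have start: "wp (Do (IConst (Dir 4) 0)) (rep u0 v) s"
    using rep by (auto simp: u0_def rep_def exec_simps)
  have J: "wp (Seq (window_length 2) (Seq compute_J (raise_alarm 2))) (rep u1 v) r"
    if "rep u0 v r" for r
    using test_J_wp[OF that] pos by (simp add: u1_def u0_def J_def)
  have K: "wp (Seq (window_length 3) (Seq compute_K (raise_alarm 3))) (rep u2 v) r"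
    if "rep u1 v r" for r
    using test_K_wp[OF that] pos by (simp add: u2_def u1_def u0_def K_def M_def)
  have out: "wp update_output ?Q r" if "rep u2 v r" "u 1 < u 5" for r
    using update_output_wp[OF that(1)] pos that(2) unfolding u2_def u1_def u0_def A_def
    by (cases "\<bar>J\<bar> \<ge> v 2"; cases "\<bar>K\<bar> \<ge> v 3") simp_all
  have "wp (If (ILess (Dir 1) (Dir 5))
      (Seq (Seq (window_length 2) (Seq compute_J (raise_alarm 2)))
      (Seq (Seq (window_length 3) (Seq compute_K (raise_alarm 3)))
           update_output))
      Skip) ?Q r" if r: "rep u0 v r" for r
  proof (cases "u 1 < u 5")
    case True
    have "wp (Seq (Seq (window_length 2) (Seq compute_J (raise_alarm 2)))
        (Seq (Seq (window_length 3) (Seq compute_K (raise_alarm 3))) update_output)) ?Q r"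
      \<comment> \<open>This instance separates the two tests and the output update but leaves each
        test whole, as \<open>J\<close> and \<open>K\<close> need.\<close>
      unfolding wp_Seq[of "Seq _ _"]
      by (rule wp_mono[OF J[OF r]], rule wp_mono[OF K], assumption, rule out[OF _ True])
    then show ?thesis
      using r True by (simp add: rep_def u0_def exec_simps del: wp_Seq)
  next
    case False
    then show ?thesis
      using r by (simp add: rep_def u0_def exec_simps A_def del: wp_Seq)
  qed
  with start show ?thesis
    unfolding decide_def wp_Seq[of "Do _"] by (rule wp_mono)
qed

section \<open>The memory invariant along the stream\<close>

locale floc_input =
  fixes n k N_J N_K :: nat and \<rho>_J \<rho>_K :: real and ab :: "real \<times> real" and X :: "nat \<Rightarrow> real"
  assumes pos: "0 < n" "0 < N_J" "0 < N_K"
    and windows: "\<And>m. k < m \<Longrightarrow> m \<le> n \<Longrightarrow> window N_J m \<le> m \<and> window N_K m \<le> m"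
begin

definition alarm :: "nat \<Rightarrow> bool" where
  "alarm m \<longleftrightarrow> \<bar>J_stat n N_J ab X m\<bar> \<ge> \<rho>_J \<or> \<bar>K_stat n N_K ab X m\<bar> \<ge> \<rho>_K"

definition P :: "nat \<Rightarrow> real" where
  "P = cumsum (resid n ab X)"

definition Q :: "nat \<Rightarrow> real" where
  "Q = cumsum (\<lambda>i. real i * resid n ab X i)"

text \<open>Data cell 4 is unconstrained, as \<open>feed\<close> overwrites it. Each register lists
  the bin starts oldest first, so its first cell belongs to the window start.\<close>

definition state :: "nat \<Rightarrow> (nat \<Rightarrow> nat) \<Rightarrow> (nat \<Rightarrow> real) \<Rightarrow> bool" where
  "state m u v \<longleftrightarrow>
     u 0 = n \<and> u 1 = k \<and> u 2 = N_J \<and> u 3 = N_K \<and>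
     u 4 = (if k < m \<and> alarm m then 1 else 0) \<and> u 5 = m \<and>
     v 0 = fst ab \<and> v 1 = snd ab \<and> v 2 = \<rho>_J \<and> v 3 = \<rho>_K \<and>
     v 5 = first_alarm n k alarm m \<and> v 6 = P m \<and> v 7 = Q m \<and>
     [v 8, v 9, v 10] = map (\<lambda>j. P (bin_start N_J j m)) [2, 1, 0] \<and>
     [v 11, v 12, v 13] = map (\<lambda>j. P (bin_start N_K j m)) [2, 1, 0] \<and>
     [v 14, v 15, v 16] = map (\<lambda>j. Q (bin_start N_K j m)) [2, 1, 0]"

definition inv :: "nat \<Rightarrow> store \<Rightarrow> bool" where
  "inv m s \<longleftrightarrow> (\<exists>u v. rep u v s \<and> state m u v)"

text \<open>At time 0 all bin starts are 0 and cumulative sums vanish there, matching the zeroed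
  registers.\<close>

lemma init_prog_inv: "wp init_prog (inv 0) (input_store n k N_J N_K ab \<rho>_J \<rho>_K)"
  by (rule wp_mono[OF init_prog_wp], unfold inv_def, intro exI conjI, assumption)
    (auto simp: state_def first_alarm_0 P_def Q_def)

lemma P_Suc: "P (Suc m) = P m + resid n ab X (Suc m)"
  and Q_Suc: "Q (Suc m) = Q m + real (Suc m) * resid n ab X (Suc m)"
  by (simp_all add: P_def Q_def cumsum_Suc)

lemma step_prog_inv:
  assumes "inv m s" "m < n"
  shows "wp step_prog (inv (Suc m)) (feed (X (Suc m)) s)"
proof -
  obtain u v where rep: "rep u v s" and state: "state m u v"
    using assms(1) by (auto simp: inv_def)
  let ?m = "Suc m"
  define u1 where "u1 = u(5 := ?m)"
  define e where "e = resid n ab X ?m"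
  define v1 where "v1 = v(4 := X ?m, 6 := v 6 + e, 7 := v 7 + real ?m * e)"
  define v2 where "v2 = (if ?m mod N_J = 0 then v1(8 := v1 9, 9 := v1 10, 10 := v1 6) else v1)"
  define v3 where "v3 = (if ?m mod N_K = 0 then v2(11 := v2 12, 12 := v2 13, 13 := v2 6) else v2)"
  define v4 where "v4 = (if ?m mod N_K = 0 then v3(14 := v3 15, 15 := v3 16, 16 := v3 7) else v3)"
  have u: "u 0 = n" "u 1 = k" "u 2 = N_J" "u 3 = N_K" "u 5 = m"
    using state by (simp_all add: state_def)
  have u1: "u1 0 = n" "u1 1 = k" "u1 2 = N_J" "u1 3 = N_K" "u1 5 = ?m"
    using u by (simp_all add: u1_def)
  have cells: "v4 0 = fst ab" "v4 1 = snd ab" "v4 2 = \<rho>_J" "v4 3 = \<rho>_K"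
    "v4 5 = first_alarm n k alarm m" "v4 6 = P ?m" "v4 7 = Q ?m"
    using state by (simp_all add: state_def v4_def v3_def v2_def v1_def P_Suc Q_Suc e_def)
  \<comment> \<open>At a multiple of the bin size, the entries for \<open>j = 2, 1\<close> shift by
    \<open>bin_start_Suc\<close>, and the newest becomes \<open>P ?m\<close> or \<open>Q ?m\<close>,
    which cells 6 and 7 already hold.\<close>
  have bins: "[v4 8, v4 9, v4 10] = map (\<lambda>j. P (bin_start N_J j ?m)) [2, 1, 0]"
    "[v4 11, v4 12, v4 13] = map (\<lambda>j. P (bin_start N_K j ?m)) [2, 1, 0]"
    "[v4 14, v4 15, v4 16] = map (\<lambda>j. Q (bin_start N_K j ?m)) [2, 1, 0]"
    using state
    by (simp_all add: state_def v4_def v3_def v2_def v1_def P_Suc Q_Suc e_def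
        bin_start_Suc bin_start_0_Suc numeral_2_eq_2)
  define J where "J = (v4 6 - v4 8) / real (window (u1 2) (u1 5))"
  define M where "M = window (u1 3) (u1 5)"
  define K where "K = 6 * ((v4 7 - v4 14 - real (u1 5 - M) * (v4 6 - v4 11)) /
      (real M * (real M + 1) * (real M + 1 + real M)))"
  define A where "A \<longleftrightarrow> u1 1 < u1 5 \<and> (\<bar>J\<bar> \<ge> v4 2 \<or> \<bar>K\<bar> \<ge> v4 3)"
  define u5 where "u5 = u1(4 := if A then 1 else 0)"
  define v5 where "v5 = (if A then v4(5 := min (real (u1 5) / real (u1 0)) (v4 5)) else v4)"
  \<comment> \<open>The windows are guaranteed to fit only after time \<open>k\<close>; up to then
    both the program and the invariant give decision 0.\<close>
  have JK: "J = J_stat n N_J ab X ?m" "K = K_stat n N_K ab X ?m" if "k < ?m"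
  proof -
    have w: "window N_J ?m \<le> ?m" "window N_K ?m \<le> ?m"
      using windows[of ?m] that assms(2) by auto
    show "J = J_stat n N_J ab X ?m"
      using bins(1) cells w(1) by (simp add: J_def u1 J_stat_cumsum P_def)
    show "K = K_stat n N_K ab X ?m"
      using bins(2,3) cells w(2)
      by (simp add: K_def M_def u1 K_stat_cumsum diff_window P_def Q_def)
  qed
  then have A: "A \<longleftrightarrow> k < ?m \<and> alarm ?m"
    unfolding A_def alarm_def u1 cells by auto
  have "state ?m u5 v5"
    using u1 cells bins by (simp add: state_def u5_def v5_def A first_alarm_Suc)
  then have final: "rep u5 v5 r \<Longrightarrow> inv ?m r" for r
    by (auto simp: inv_def)
  have acc: "wp accumulate (rep u1 v1) (feed (X ?m) s)"
    using accumulate_wp[OF rep_feed[OF rep]] pos state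
    by (simp add: u1_def v1_def e_def Let_def resid_def pre_fit_def state_def)
  have shift1: "wp (shift_bins 2 6 8) (rep u1 v2) r" if "rep u1 v1 r" for r
    using shift_bins_wp[OF that, of 2 6 8] pos
    by (simp add: v2_def u1 split del: if_split cong: if_cong)
  have shift2: "wp (shift_bins 3 6 11) (rep u1 v3) r" if "rep u1 v2 r" for r
    using shift_bins_wp[OF that, of 3 6 11] pos
    by (simp add: v3_def u1 split del: if_split cong: if_cong)
  have shift3: "wp (shift_bins 3 7 14) (rep u1 v4) r" if "rep u1 v3 r" for r
    using shift_bins_wp[OF that, of 3 7 14] pos
    by (simp add: v4_def u1 split del: if_split cong: if_cong)
  have "wp decide (rep u5 v5) r" if "rep u1 v4 r" for r
    using decide_wp[OF that] pos unfolding u5_def v5_def A_def J_def K_def M_def by (simp add: u1)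
  then have dec: "wp decide (inv ?m) r" if "rep u1 v4 r" for r
    using that by (blast intro: wp_mono final)
  show ?thesis
    unfolding step_prog_def wp_Seq
    by (rule wp_mono[OF acc], rule wp_mono[OF shift1], assumption,
        rule wp_mono[OF shift2], assumption, rule wp_mono[OF shift3], assumption, rule dec)
qed

text \<open>The bound counts 9 index cells and 21 data cells, the fixed address ranges in
  \<open>rep\<close>.\<close>

lemma inv_storage: "inv m s \<Longrightarrow> storage s \<le> 30"
proof -
  assume "inv m s"
  then have "card (dom (idx s)) \<le> card {..8::nat}" "card (dom (dat s)) \<le> card {..20::nat}"
    by (auto simp: inv_def rep_def simp del: card_atMost intro!: card_mono)
  then show ?thesis
    by (simp add: storage_def)
qed

lemma inv_decision: "inv m s \<Longrightarrow> k < m \<Longrightarrow> decision s = Some (if alarm m then 1 else 0)"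
  by (auto simp: inv_def rep_def state_def decision_def)

lemma inv_output:
  assumes "inv n s"
  shows "detector_output s = Some (floc_detector n k N_J N_K \<rho>_J \<rho>_K ab X)"
proof -
  have "detector_output s = Some (first_alarm n k alarm n)"
    using assms by (auto simp: inv_def rep_def state_def detector_output_def)
  then show ?thesis
    using pos
    by (simp add: floc_detector_def detection_time_first_alarm alarm_def[abs_def]
        first_alarm_disj)
qed

lemma ex_stream_run:
  "\<exists>S T. stream_run \<lparr>init = init_prog, step = step_prog\<rparr>
     (input_store n k N_J N_K ab \<rho>_J \<rho>_K) X n S T \<and> (\<forall>m\<le>n. inv m (S m)) \<and>
     (\<forall>m. T m \<le> max (cost init_prog) (cost step_prog))"
proof -
  let ?c = "max (cost init_prog) (cost step_prog)"
  have loop_free: "loop_free init_prog" "loop_free step_prog"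
    by (simp_all add: init_prog_def step_prog_def accumulate_def shift_bins_def decide_def
        window_length_def compute_J_def compute_K_def raise_alarm_def update_output_def
        del: instrs.simps)
  obtain t0 s0 where s0: "exec init_prog (input_store n k N_J N_K ab \<rho>_J \<rho>_K) t0 s0" "inv 0 s0"
    using init_prog_inv by (auto simp: wp_def)
  have "\<exists>S. S 0 = s0 \<and> (\<forall>m. (m \<le> n \<longrightarrow> inv m (S m)) \<and>
    (m < n \<longrightarrow> (\<exists>t. exec step_prog (feed (X (Suc m)) (S m)) t (S (Suc m)))))"
  proof -
    \<comment> \<open>With the hypotheses inside the existential, a successor exists for every
      \<open>m\<close> and \<open>s\<close>; choosing one gives \<open>f\<close>, and recursion from
      \<open>s0\<close> gives the sequence of stores.\<close>
    have "\<exists>r. m < n \<longrightarrow> inv m s \<longrightarrow>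
        inv (Suc m) r \<and> (\<exists>t. exec step_prog (feed (X (Suc m)) s) t r)" for m s
      using step_prog_inv[of m s] by (auto simp: wp_def)
    then obtain f where f: "\<And>m s. m < n \<Longrightarrow> inv m s \<Longrightarrow>
        inv (Suc m) (f m s) \<and> (\<exists>t. exec step_prog (feed (X (Suc m)) s) t (f m s))"
      by metis
    define S where "S = rec_nat s0 f"
    have "m \<le> n \<longrightarrow> inv m (S m)" for m
      by (induction m) (use s0(2) f in \<open>auto simp: S_def\<close>)
    then show ?thesis
      using f by (intro exI[of _ S]) (auto simp: S_def)
  qed
  then obtain S where S: "\<And>m. m \<le> n \<Longrightarrow> inv m (S m)" "S 0 = s0"
    "\<And>m. m < n \<Longrightarrow> \<exists>t. exec step_prog (feed (X (Suc m)) (S m)) t (S (Suc m))"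
    by blast
  \<comment> \<open>Beyond \<open>n\<close> any time below the bound will do, such as
    \<open>t0\<close>, so that \<open>T\<close> can be chosen as a total function.\<close>
  have "\<exists>t\<le>?c. m \<le> n \<longrightarrow>
      (if m = 0 then exec init_prog (input_store n k N_J N_K ab \<rho>_J \<rho>_K) t (S 0)
       else exec step_prog (feed (X m) (S (m - 1))) t (S m))" for m
  proof (cases "0 < m \<and> m \<le> n")
    case True
    then obtain t where "exec step_prog (feed (X m) (S (m - 1))) t (S m)"
      using S(3)[of "m - 1"] by (cases m) auto
    then show ?thesis
      using exec_cost[OF _ loop_free(2)] True by (auto simp: le_max_iff_disj)
  next
    case False
    then show ?thesis
      using s0(1) exec_cost[OF s0(1) loop_free(1)] S(2) by (auto simp: le_max_iff_disj)
  qed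
  then obtain T where T: "\<And>m. T m \<le> ?c" "\<And>m. m \<le> n \<Longrightarrow>
      if m = 0 then exec init_prog (input_store n k N_J N_K ab \<rho>_J \<rho>_K) (T m) (S 0)
      else exec step_prog (feed (X m) (S (m - 1))) (T m) (S m)"
    by metis
  have "stream_run \<lparr>init = init_prog, step = step_prog\<rparr>
      (input_store n k N_J N_K ab \<rho>_J \<rho>_K) X n S T"
    unfolding stream_run_def
  proof (intro conjI ballI)
    show "exec (init \<lparr>init = init_prog, step = step_prog\<rparr>)
        (input_store n k N_J N_K ab \<rho>_J \<rho>_K) (T 0) (S 0)"
      using T(2)[of 0] by simp
    show "exec (step \<lparr>init = init_prog, step = step_prog\<rparr>) (feed (X m) (S (m - 1))) (T m) (S m)"
      if "m \<in> {1..n}" for m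
      using T(2)[of m] that by simp
  qed
  with S(1) T(1) show ?thesis
    by blast
qed

end

theorem proposition4:
  shows "\<exists>(A :: stream_alg) (C_time :: nat) (C_storage :: nat).
    \<forall>(n :: nat) (k :: nat) (N_J :: nat) (N_K :: nat) (\<rho>_J :: real) (\<rho>_K :: real)
      (X :: nat \<Rightarrow> real) (ab :: real \<times> real).
      1 \<le> k \<and> k \<le> n \<and> 1 \<le> N_J \<and> N_J \<le> n \<and> 1 \<le> N_K \<and> N_K \<le> n \<and> 0 < \<rho>_J \<and> 0 < \<rho>_K \<and>
      (\<forall>m. k < m \<and> m \<le> n \<longrightarrow> window N_J m \<le> m \<and> window N_K m \<le> m) \<and>
      is_pre_change_estimate n k X ab \<longrightarrow>
      (\<exists>S T.
        stream_run A (input_store n k N_J N_K ab \<rho>_J \<rho>_K) X n S T \<and>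
        (\<forall>m. k < m \<and> m \<le> n \<longrightarrow>
          decision (S m) = Some (if \<bar>J_stat n N_J ab X m\<bar> \<ge> \<rho>_J \<or> \<bar>K_stat n N_K ab X m\<bar> \<ge> \<rho>_K
                                 then 1 else 0)) \<and>
        detector_output (S n) = Some (floc_detector n k N_J N_K \<rho>_J \<rho>_K ab X) \<and>
        (\<forall>m\<le>n. T m \<le> C_time) \<and>
        (\<forall>m\<le>n. storage (S m) \<le> C_storage))"
\<comment> \<open>The witnesses are given before any parameter is fixed: two fixed programs, the
  larger of their syntactic costs, and 30 cells. Hence the bounds are absolute.\<close>
proof (rule exI[of _ "\<lparr>init = init_prog, step = step_prog\<rparr>"],
    rule exI[of _ "max (cost init_prog) (cost step_prog)"], rule exI[of _ 30],
    intro allI impI, elim conjE)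
  fix n k N_J N_K :: nat and \<rho>_J \<rho>_K :: real and X :: "nat \<Rightarrow> real" and ab :: "real \<times> real"
  assume "1 \<le> k" "k \<le> n" "1 \<le> N_J" "1 \<le> N_K"
    and "\<forall>m. k < m \<and> m \<le> n \<longrightarrow> window N_J m \<le> m \<and> window N_K m \<le> m"
  then interpret floc_input n k N_J N_K \<rho>_J \<rho>_K ab X
    by unfold_locales auto
  obtain S T where run: "stream_run \<lparr>init = init_prog, step = step_prog\<rparr>
      (input_store n k N_J N_K ab \<rho>_J \<rho>_K) X n S T"
    and inv: "\<And>m. m \<le> n \<Longrightarrow> inv m (S m)"
    and time: "\<And>m. T m \<le> max (cost init_prog) (cost step_prog)"
    using ex_stream_run by blast
  show "\<exists>S T.
      stream_run \<lparr>init = init_prog, step = step_prog\<rparr>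
        (input_store n k N_J N_K ab \<rho>_J \<rho>_K) X n S T \<and>
      (\<forall>m. k < m \<and> m \<le> n \<longrightarrow>
        decision (S m) = Some (if \<bar>J_stat n N_J ab X m\<bar> \<ge> \<rho>_J \<or> \<bar>K_stat n N_K ab X m\<bar> \<ge> \<rho>_K
                               then 1 else 0)) \<and>
      detector_output (S n) = Some (floc_detector n k N_J N_K \<rho>_J \<rho>_K ab X) \<and>
      (\<forall>m\<le>n. T m \<le> max (cost init_prog) (cost step_prog)) \<and>
      (\<forall>m\<le>n. storage (S m) \<le> 30)"
    using run time inv_output[OF inv] inv_storage[OF inv] inv_decision[OF inv]
    by (intro exI[of _ S] exI[of _ T]) (simp add: alarm_def)
qed

end
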